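(* Let $n_1,n_2,n_3\ge 1$. For any tensor $\mathcal{T}\in\mathbb{R}^{n_1\times n_2\times n_3}$ there exists a set $\Theta\subseteq\mathbb{B}^{n_1}$ with $|\Theta|\le n_1n_2n_3$ such that $$\|\mathcal{T}\|_*=\min_{\Lambda}\left\{\frac12\sum_{\mathbf{x}\in\Theta}\operatorname{tr}(\Lambda(\mathbf{x}))\;:\;\mathcal{T}=\sum_{\mathbf{x}\in\Theta}\mathbf{x}\otimes\Gamma(\mathbf{x}),\quad \Lambda(\mathbf{x})=\begin{bmatrix}\Lambda^{(1)}(\mathbf{x})&\Gamma(\mathbf{x})\\ \Gamma(\mathbf{x})^\top&\Lambda^{(2)}(\mathbf{x})\end{bmatrix}\succeq 0\ \text{ for all }\mathbf{x}\in\Theta\right\},$$ where the minimum is over families $(\Lambda(\mathbf{x}))_{\mathbf{x}\in\Theta}$ of symmetric matrices of size $(n_2+n_3)\times(n_2+n_3)$ with blocks $\Lambda^{(1)}(\mathbf{x})\in\mathbb{R}^{n_2\times n_2}$, $\Gamma(\mathbf{x})\in\mathbb{R}^{n_2\times n_3}$, $\Lambda^{(2)}(\mathbf{x})\in\mathbb{R}^{n_3\times n_3}$.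
   Context: $\mathbb{B}^{n}=\{\mathbf{x}\in\mathbb{R}^n:\|\mathbf{x}\|=1\}$ is the Euclidean unit sphere. $\otimes$ is the outer product: for $\mathbf{x}\in\mathbb{R}^{n_1}$ and $\Gamma\in\mathbb{R}^{n_2\times n_3}$, $\mathbf{x}\otimes\Gamma\in\mathbb{R}^{n_1\times n_2\times n_3}$ has entries $(\mathbf{x}\otimes\Gamma)(j_1,j_2,j_3)=x_{j_1}\Gamma(j_2,j_3)$. The tensor nuclear norm of $\mathcal{T}\in\mathbb{R}^{n_1\times n_2\times n_3}$ is $$\|\mathcal{T}\|_*=\min\left\{\sum_{r=1}^R|\lambda_r|:\ \mathcal{T}=\sum_{r=1}^R\lambda_r\,\mathbf{x}_1^{(r)}\otimes\mathbf{x}_2^{(r)}\otimes\mathbf{x}_3^{(r)},\ R\in\mathbb{N},\ \lambda_r\in\mathbb{R},\ \mathbf{x}_\ell^{(r)}\in\mathbb{R}^{n_\ell},\ \|\mathbf{x}_\ell^{(r)}\|=1\ \forall \ell\in\{1,2,3\},\,r\in\{1,\dots,R\}\right\}$$ (the minimum is attained). *)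

theory Defs
  imports "HOL-Analysis.Analysis"
begin

text \<open>A real \<open>n1 \<times> n2 \<times> n3\<close> tensor is an element of \<^typ>\<open>real^'n3^'n2^'n1\<close>, its
  entry at \<open>(i, j, k)\<close> being \<open>T $ i $ j $ k\<close>.\<close>

text \<open>The second factor ranges over any real vector space, so that the same operation covers
  vector \<open>\<otimes>\<close> vector (a matrix) and vector \<open>\<otimes>\<close> matrix (a third-order tensor); see the entry
  formulas below.\<close>

definition outer :: "real^'n \<Rightarrow> 'v::real_vector \<Rightarrow> 'v^'n" (infixr "\<otimes>\<^sub>o" 75)
  where "x \<otimes>\<^sub>o G = (\<chi> i. (x $ i) *\<^sub>R G)"

lemma outer_matrix_nth: "(x \<otimes>\<^sub>o (G :: real^'n3^'n2)) $ i $ j $ k = x $ i * G $ j $ k"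
  by (simp add: outer_def)

lemma outer_vectors_nth: "(x \<otimes>\<^sub>o y \<otimes>\<^sub>o (z :: real^'n3)) $ i $ j $ k = x $ i * y $ j * z $ k"
  by (simp add: outer_def)

text \<open>The costs \<open>\<Sum>r. \<bar>\<lambda> r\<bar>\<close> of all decompositions of a tensor into finitely many rank-one
  unit tensors.\<close>

definition nuclear_costs :: "real^'n3^'n2^'n1 \<Rightarrow> real set"
  where "nuclear_costs T =
    {(\<Sum>r=1..R. \<bar>l r\<bar>) | (R::nat) l x1 x2 x3.
       T = (\<Sum>r=1..R. l r *\<^sub>R (x1 r \<otimes>\<^sub>o x2 r \<otimes>\<^sub>o x3 r)) \<and>
       (\<forall>r\<in>{1..R}. norm (x1 r) = 1 \<and> norm (x2 r) = 1 \<and> norm (x3 r) = 1)}"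

text \<open>The set of costs is nonempty and bounded below by \<open>0\<close>; the infimum is attained, so that it
  is the minimum.\<close>

definition nuclear_norm :: "real^'n3^'n2^'n1 \<Rightarrow> real"
  where "nuclear_norm T = Inf (nuclear_costs T)"

definition block_matrix ::
    "real^'m^'m \<Rightarrow> real^'n^'m \<Rightarrow> real^'m^'n \<Rightarrow> real^'n^'n \<Rightarrow> real^('m + 'n)^('m + 'n)"
  where "block_matrix A B C D =
    (\<chi> i j. case i of
        Inl p \<Rightarrow> (case j of Inl q \<Rightarrow> A $ p $ q | Inr q \<Rightarrow> B $ p $ q)
      | Inr p \<Rightarrow> (case j of Inl q \<Rightarrow> C $ p $ q | Inr q \<Rightarrow> D $ p $ q))"

definition psd :: "real^'n^'n \<Rightarrow> bool"
  where "psd A \<longleftrightarrow> transpose A = A \<and> (\<forall>v. 0 \<le> v \<bullet> (A *v v))"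

definition is_minimum :: "real \<Rightarrow> real set \<Rightarrow> bool"
  where "is_minimum m S \<longleftrightarrow> m \<in> S \<and> (\<forall>s\<in>S. m \<le> s)"

end

theory Submission
  imports Defs
begin

text \<open>The nuclear norm is the gauge of the convex hull of the compact set of rank-one unit
  tensors, hence attained; a conic Caratheodory argument turns an optimal decomposition into one
  with linearly independent terms, thus with at most \<open>n1 n2 n3\<close> of them. Let \<open>\<Theta>\<close> be the set
  of its first factors. Grouping the terms \<open>\<lambda> x \<otimes> y \<otimes> z\<close> by \<open>x\<close>, the matrices
  \<open>\<Lambda> x = \<Sum> \<lambda> (y, z) (y, z)\<^sup>T\<close> are feasible and have half trace \<open>\<Sum> \<lambda>\<close>. Conversely, a positive
  semidefinite \<open>\<Lambda> x\<close> is a sum of matrices \<open>(a, b) (a, b)\<^sup>T\<close>, so that \<open>\<Gamma> x = \<Sum> a \<otimes> b\<close>, and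
  \<open>\<Sum> \<parallel>a\<parallel> \<parallel>b\<parallel> \<le> 1/2 \<Sum> (\<parallel>a\<parallel>\<^sup>2 + \<parallel>b\<parallel>\<^sup>2)\<close> is half the trace of \<open>\<Lambda> x\<close>.\<close>

section \<open>The outer product\<close>

lemma outer_nth [simp]: "(x \<otimes>\<^sub>o G) $ i = (x $ i) *\<^sub>R G"
  by (simp add: outer_def)

lemma outer_0_left [simp]: "0 \<otimes>\<^sub>o G = 0"
  by (simp add: vec_eq_iff)

lemma outer_scaleR_left: "(c *\<^sub>R x) \<otimes>\<^sub>o G = c *\<^sub>R (x \<otimes>\<^sub>o G)"
  by (simp add: vec_eq_iff)

lemma outer_scaleR_right: "x \<otimes>\<^sub>o (c *\<^sub>R G) = c *\<^sub>R (x \<otimes>\<^sub>o G)"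
  by (simp add: vec_eq_iff)

lemma outer_sum_right: "x \<otimes>\<^sub>o (\<Sum>i\<in>I. G i) = (\<Sum>i\<in>I. x \<otimes>\<^sub>o G i)"
  by (simp add: vec_eq_iff scaleR_sum_right)

lemma outer_mult_vec: "(x \<otimes>\<^sub>o y) *v v = (y \<bullet> v) *\<^sub>R (x :: real^'m)"
  by (simp add: vec_eq_iff matrix_vector_mult_def inner_vec_def sum_distrib_left mult_ac)

section \<open>Positive semidefinite matrices\<close>

lemma psd_0: "psd 0"
  by (simp add: psd_def vec_eq_iff transpose_def)

lemma psd_add: "psd A \<Longrightarrow> psd B \<Longrightarrow> psd (A + B)"
  by (simp add: psd_def vec_eq_iff transpose_def matrix_vector_mult_add_rdistrib inner_add_right)

lemma psd_scaleR_outer_self: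
  assumes "0 \<le> c"
  shows "psd (c *\<^sub>R (x \<otimes>\<^sub>o x :: real^'n^'n))"
proof -
  have "v \<bullet> ((c *\<^sub>R (x \<otimes>\<^sub>o x)) *v v) = c * (x \<bullet> v)\<^sup>2" for v :: "real^'n"
    by (simp add: scaleR_matrix_vector_assoc[symmetric] outer_mult_vec power2_eq_square inner_commute)
  then show ?thesis
    using assms by (simp add: psd_def vec_eq_iff transpose_def mult.commute)
qed

lemma psd_sum: "(\<And>i. i \<in> I \<Longrightarrow> psd (A i)) \<Longrightarrow> psd (\<Sum>i\<in>I. A i)"
  by (induction I rule: infinite_finite_induct) (auto simp: psd_0 psd_add)

lemma psd_symmetric: "psd A \<Longrightarrow> A $ i $ j = A $ j $ i"
  unfolding psd_def transpose_def by (metis vec_lambda_beta)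

lemma psd_inner_commute:
  assumes "psd A"
  shows "x \<bullet> (A *v y) = (A *v x) \<bullet> y"
  using assms unfolding psd_def by (metis dot_lmul_matrix transpose_matrix_vector)

lemma inner_axis_matrix_vector: "axis i 1 \<bullet> (A *v x) = (A *v x) $ i" for A :: "real^'n^'m"
  by (simp add: inner_axis')

lemma matrix_vector_axis_nth: "(A *v axis i 1) $ j = A $ j $ i" for A :: "real^'n^'m"
  by (simp add: matrix_vector_mul_component inner_axis)

text \<open>The quadratic form at \<open>t e\<^sub>i + v\<close>.\<close>

lemma psd_quadratic:
  fixes A :: "real^'n^'n"
  assumes "psd A"
  shows "0 \<le> t\<^sup>2 * (A $ i $ i) + 2 * t * (A *v v) $ i + v \<bullet> (A *v v)"
proof -
  let ?e = "axis i 1 :: real^'n"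
  have "v \<bullet> (A *v ?e) = (A *v v) $ i"
    using psd_inner_commute[OF assms, of v ?e] by (simp add: inner_axis)
  then have "(t *\<^sub>R ?e + v) \<bullet> (A *v (t *\<^sub>R ?e + v))
      = t\<^sup>2 * (A $ i $ i) + 2 * t * (A *v v) $ i + v \<bullet> (A *v v)"
    by (simp add: matrix_vector_right_distrib matrix_vector_mult_scaleR inner_add_left
        inner_add_right inner_axis_matrix_vector matrix_vector_axis_nth power2_eq_square algebra_simps)
  with assms show ?thesis
    unfolding psd_def by metis
qed

lemma psd_diag_nonneg: "psd A \<Longrightarrow> 0 \<le> A $ i $ i"
  using psd_quadratic[of A 1 i 0] by simp

text \<open>With a zero diagonal entry, the quadratic form at \<open>t e_i + e_j\<close> is affine
  in \<open>t\<close>; it stays nonnegative for all real \<open>t\<close> only if its slope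
  vanishes.\<close>

lemma psd_diag_0_imp_row_0:
  assumes "psd A" "A $ i $ i = 0"
  shows "A $ i $ j = 0"
proof (rule ccontr)
  assume "A $ i $ j \<noteq> 0"
  define a where "a = A $ i $ j"
  define b where "b = A $ j $ j"
  have "axis j 1 \<bullet> (A *v axis j 1) = b"
    by (simp add: inner_axis_matrix_vector matrix_vector_axis_nth b_def)
  then have *: "0 \<le> 2 * t * a + b" for t
    using psd_quadratic[OF assms(1), of t i "axis j 1"] assms(2)
    by (simp add: matrix_vector_axis_nth a_def)
  \<comment> \<open>At this \<open>t\<close> the affine function takes the value
    \<open>-1\<close>.\<close>
  from *[of "- (b + 1) / (2 * a)"] \<open>A $ i $ j \<noteq> 0\<close> show False
    by (simp add: a_def field_simps)
qed

text \<open>One step of the Cholesky decomposition.\<close>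

lemma psd_schur_complement:
  assumes "psd A" "A $ i $ i > 0"
  defines "v \<equiv> (1 / sqrt (A $ i $ i)) *\<^sub>R (A *v axis i 1)"
  shows "psd (A - v \<otimes>\<^sub>o v)"
proof -
  let ?a = "A $ i $ i"
  have "0 \<le> w \<bullet> ((A - v \<otimes>\<^sub>o v) *v w)" for w
  proof -
    define b where "b = (A *v w) $ i"
    have "(A *v axis i 1) \<bullet> w = b"
      using psd_inner_commute[OF assms(1), of "axis i 1" w]
      by (simp add: b_def inner_axis_matrix_vector)
    then have "v \<bullet> w = b / sqrt ?a"
      by (simp add: v_def)
    then have "w \<bullet> ((A - v \<otimes>\<^sub>o v) *v w) = w \<bullet> (A *v w) - b\<^sup>2 / ?a"
      using assms(2)
      by (simp add: matrix_vector_mult_diff_rdistrib inner_diff_right outer_mult_vec inner_commute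
          power2_eq_square)
    \<comment> \<open>The point \<open>- b / ?a\<close> minimises the quadratic in \<open>t\<close>,
      and the minimal value is exactly the form of the Schur complement at \<open>w\<close>.\<close>
    moreover have "0 \<le> (- b / ?a)\<^sup>2 * ?a + 2 * (- b / ?a) * b + w \<bullet> (A *v w)"
      using psd_quadratic[OF assms(1)] unfolding b_def by blast
    ultimately show ?thesis
      using assms(2) by (simp add: power2_eq_square)
  qed
  moreover have "transpose (A - v \<otimes>\<^sub>o v) = A - v \<otimes>\<^sub>o v"
    using psd_symmetric[OF assms(1)] by (simp add: vec_eq_iff transpose_def mult.commute)
  ultimately show ?thesis
    by (simp add: psd_def)
qed

text \<open>Cholesky elimination, one index of \<open>J\<close> at a time: subtracting a suitable
  \<open>w \<otimes>\<^sub>o w\<close> clears the diagonal entry at \<open>i\<close> and keeps the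
  matrix positive semidefinite. Once the diagonal is zero, so is the matrix.\<close>

lemma psd_eq_sum_outer_on:
  assumes "finite J" "psd A" "\<And>j. j \<notin> J \<Longrightarrow> A $ j $ j = 0"
  shows "\<exists>v. A = (\<Sum>j\<in>J. v j \<otimes>\<^sub>o v j)"
  using assms
proof (induction J arbitrary: A rule: finite_induct)
  case empty
  then have "A $ i $ j = 0" for i j
    using psd_diag_0_imp_row_0 by blast
  then have "A = 0"
    by (simp add: vec_eq_iff)
  then show ?case by simp
next
  case (insert i J)
  have "\<exists>w. psd (A - w \<otimes>\<^sub>o w) \<and> (\<forall>j. j \<notin> J \<longrightarrow> (A - w \<otimes>\<^sub>o w) $ j $ j = 0)"
  proof (cases "A $ i $ i = 0")
    case True
    then have "A $ j $ j = 0" if "j \<notin> J" for j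
      using insert.prems(2)[of j] that by (cases "j = i") auto
    \<comment> \<open>A zero pivot leaves nothing to eliminate, so \<open>w = 0\<close>.\<close>
    with insert.prems(1) show ?thesis
      by (intro exI[of _ 0]) simp
  next
    case False
    then have pos: "A $ i $ i > 0"
      using psd_diag_nonneg[OF insert.prems(1), of i] by simp
    define w where "w = (1 / sqrt (A $ i $ i)) *\<^sub>R (A *v axis i 1)"
    \<comment> \<open>The formula gives zero at \<open>j = i\<close>, and it creates no new diagonal
      entry outside \<open>J\<close>, because there the whole row of \<open>A\<close> already
      vanishes.\<close>
    have "(A - w \<otimes>\<^sub>o w) $ j $ j = A $ j $ j - (A $ j $ i)\<^sup>2 / A $ i $ i" for j
      using pos by (simp add: w_def matrix_vector_axis_nth power2_eq_square)
    moreover have "A $ j $ i = 0" if "j \<notin> insert i J" for j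
      using psd_diag_0_imp_row_0[OF insert.prems(1)] insert.prems(2) that by blast
    ultimately have "(A - w \<otimes>\<^sub>o w) $ j $ j = 0" if "j \<notin> J" for j
      using that insert.prems(2)[of j] pos by (cases "j = i") (auto simp: power2_eq_square)
    then show ?thesis
      using psd_schur_complement[OF insert.prems(1) pos] unfolding w_def by blast
  qed
  then obtain w where w: "psd (A - w \<otimes>\<^sub>o w)" "\<And>j. j \<notin> J \<Longrightarrow> (A - w \<otimes>\<^sub>o w) $ j $ j = 0"
    by blast
  from insert.IH[OF this] obtain v where v: "A - w \<otimes>\<^sub>o w = (\<Sum>j\<in>J. v j \<otimes>\<^sub>o v j)"
    by blast
  have "(\<Sum>j\<in>insert i J. (v(i := w)) j \<otimes>\<^sub>o (v(i := w)) j) = w \<otimes>\<^sub>o w + (\<Sum>j\<in>J. v j \<otimes>\<^sub>o v j)"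
    using insert.hyps by (auto intro!: sum.cong)
  with v show ?case
    by (intro exI[of _ "v(i := w)"]) (simp add: algebra_simps)
qed

lemma psd_eq_sum_outer:
  fixes A :: "real^'n^'n"
  assumes "psd A"
  obtains v :: "'n \<Rightarrow> real^'n" where "A = (\<Sum>j\<in>UNIV. v j \<otimes>\<^sub>o v j)"
  using psd_eq_sum_outer_on[OF finite_class.finite_UNIV assms] by auto

section \<open>Blocks\<close>

lemma block_matrix_nth [simp]:
  "block_matrix A B C D $ Inl p $ Inl q = A $ p $ q"
  "block_matrix A B C D $ Inl p $ Inr r = B $ p $ r"
  "block_matrix A B C D $ Inr r $ Inl q = C $ r $ q"
  "block_matrix A B C D $ Inr r $ Inr s = D $ r $ s"
  by (simp_all add: block_matrix_def)

lemma sum_vec_eq_iff: "M = N \<longleftrightarrow> (\<forall>p. M $ Inl p = N $ Inl p) \<and> (\<forall>q. M $ Inr q = N $ Inr q)"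
  for M N :: "'v^('m::finite + 'n::finite)"
  by (metis sum.exhaust vec_eq_iff)

lemma block_matrix_outer_self:
  fixes v :: "real^('m::finite + 'n::finite)"
  defines "a \<equiv> \<chi> p. v $ Inl p" and "b \<equiv> \<chi> q. v $ Inr q"
  shows "v \<otimes>\<^sub>o v = block_matrix (a \<otimes>\<^sub>o a) (a \<otimes>\<^sub>o b) (b \<otimes>\<^sub>o a) (b \<otimes>\<^sub>o b)"
  by (simp add: a_def b_def sum_vec_eq_iff vec_eq_iff)

lemma block_matrix_sum:
  "(\<Sum>i\<in>I. block_matrix (A i) (B i) (C i) (D i)) =
   block_matrix (\<Sum>i\<in>I. A i) (\<Sum>i\<in>I. B i) (\<Sum>i\<in>I. C i) (\<Sum>i\<in>I. D i)"
  by (simp add: sum_vec_eq_iff)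

lemma block_matrix_scaleR:
  "c *\<^sub>R block_matrix A B C D = block_matrix (c *\<^sub>R A) (c *\<^sub>R B) (c *\<^sub>R C) (c *\<^sub>R D)"
  by (simp add: sum_vec_eq_iff)

lemma trace_sum: "trace (\<Sum>i\<in>I. A i) = (\<Sum>i\<in>I. trace (A i))" for A :: "'i \<Rightarrow> real^'n^'n"
  by (simp add: trace_def sum.swap[of _ I])

lemma trace_outer: "trace (x \<otimes>\<^sub>o y) = x \<bullet> y"
  by (simp add: trace_def inner_vec_def)

text \<open>Together with \<open>trace_outer\<close>, this splits the trace of
  \<open>v \<otimes>\<^sub>o v\<close> into the squared norms of the two parts of
  \<open>v\<close>.\<close>

lemma inner_sum_index:
  fixes v :: "real^('m::finite + 'n::finite)"
  shows "v \<bullet> v = (norm (\<chi> p. v $ Inl p))\<^sup>2 + (norm (\<chi> q. v $ Inr q))\<^sup>2"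
  by (simp add: power2_norm_eq_inner inner_vec_def sum.Plus flip: UNIV_Plus_UNIV)

section \<open>Attainment of the nuclear norm\<close>

text \<open>This set is closed under negation, so nonnegative coefficients suffice in decompositions
  over it.\<close>

definition rank_one_units :: "(real^'n3^'n2^'n1) set"
  where "rank_one_units = {x \<otimes>\<^sub>o y \<otimes>\<^sub>o z | x y z. norm x = 1 \<and> norm y = 1 \<and> norm z = 1}"

lemma compact_rank_one_units: "compact (rank_one_units :: (real^'n3^'n2^'n1) set)"
proof -
  let ?f = "\<lambda>(x, y, z). x \<otimes>\<^sub>o y \<otimes>\<^sub>o z :: real^'n3^'n2^'n1"
  have "continuous_on (sphere 0 1 \<times> sphere 0 1 \<times> sphere 0 1) ?f"
    unfolding outer_def case_prod_beta by (intro continuous_intros)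
  moreover have "rank_one_units = ?f ` (sphere 0 1 \<times> sphere 0 1 \<times> sphere 0 1)"
    unfolding rank_one_units_def by (force simp: image_def)
  ultimately show ?thesis
    by (metis compact_continuous_image compact_Times compact_sphere)
qed

lemma ex_unit_vector:
  fixes x :: "real^'n"
  obtains u where "norm u = 1" "x = norm x *\<^sub>R u"
proof (cases "x = 0")
  case True
  \<comment> \<open>The zero vector has no direction; any unit vector serves.\<close>
  with that[of "axis undefined 1"] show ?thesis by simp
next
  case False
  with that[of "sgn x"] show ?thesis by (simp add: norm_sgn sgn_div_norm)
qed

text \<open>Frees decompositions from the index set \<open>{1..R}\<close> and from normalised
  factors: the norms move into the coefficients, and a bijection renumbers the terms.\<close>

lemma nuclear_costs_sum:
  fixes x1 :: "'i \<Rightarrow> real^'n1" and x2 :: "'i \<Rightarrow> real^'n2" and x3 :: "'i \<Rightarrow> real^'n3"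
  assumes "finite I"
  shows "(\<Sum>i\<in>I. \<bar>l i\<bar> * (norm (x1 i) * norm (x2 i) * norm (x3 i)))
    \<in> nuclear_costs (\<Sum>i\<in>I. l i *\<^sub>R (x1 i \<otimes>\<^sub>o x2 i \<otimes>\<^sub>o x3 i))"
proof -
  obtain h where h: "bij_betw h {1..card I} I"
    using ex_bij_betw_nat_finite_1[OF assms] by blast
  have "\<exists>u. norm u = 1 \<and> x1 i = norm (x1 i) *\<^sub>R u" "\<exists>u. norm u = 1 \<and> x2 i = norm (x2 i) *\<^sub>R u"
    "\<exists>u. norm u = 1 \<and> x3 i = norm (x3 i) *\<^sub>R u" for i
    by (metis ex_unit_vector)+
  then obtain u1 u2 u3 where u:
    "\<And>i. norm (u1 i) = 1" "\<And>i. x1 i = norm (x1 i) *\<^sub>R u1 i"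
    "\<And>i. norm (u2 i) = 1" "\<And>i. x2 i = norm (x2 i) *\<^sub>R u2 i"
    "\<And>i. norm (u3 i) = 1" "\<And>i. x3 i = norm (x3 i) *\<^sub>R u3 i"
    by metis
  define m where "m i = l i * (norm (x1 i) * norm (x2 i) * norm (x3 i))" for i
  have "l i *\<^sub>R (x1 i \<otimes>\<^sub>o x2 i \<otimes>\<^sub>o x3 i) = m i *\<^sub>R (u1 i \<otimes>\<^sub>o u2 i \<otimes>\<^sub>o u3 i)" for i
    by (subst u(2), subst u(4), subst u(6))
      (simp add: m_def outer_scaleR_left outer_scaleR_right mult_ac)
  then have "(\<Sum>i\<in>I. l i *\<^sub>R (x1 i \<otimes>\<^sub>o x2 i \<otimes>\<^sub>o x3 i))
      = (\<Sum>r=1..card I. m (h r) *\<^sub>R (u1 (h r) \<otimes>\<^sub>o u2 (h r) \<otimes>\<^sub>o u3 (h r)))"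
    using sum.reindex_bij_betw[OF h, of "\<lambda>i. m i *\<^sub>R (u1 i \<otimes>\<^sub>o u2 i \<otimes>\<^sub>o u3 i)"] by simp
  moreover have "(\<Sum>i\<in>I. \<bar>l i\<bar> * (norm (x1 i) * norm (x2 i) * norm (x3 i)))
      = (\<Sum>r=1..card I. \<bar>m (h r)\<bar>)"
    using sum.reindex_bij_betw[OF h, of "\<lambda>i. \<bar>m i\<bar>"] by (simp add: m_def abs_mult)
  ultimately show ?thesis
    unfolding nuclear_costs_def using u(1,3,5)
    by (intro CollectI exI[of _ "card I"] exI[of _ "\<lambda>r. m (h r)"] exI[of _ "\<lambda>r. u1 (h r)"]
        exI[of _ "\<lambda>r. u2 (h r)"] exI[of _ "\<lambda>r. u3 (h r)"]) simp
qed

text \<open>Expanding in the standard basis, with the entries as coefficients, is already a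
  decomposition into unit rank-one tensors.\<close>

lemma nuclear_costs_nonempty: "nuclear_costs (T :: real^'n3^'n2^'n1) \<noteq> {}"
proof -
  let ?c = "\<lambda>(i, j, k). T $ i $ j $ k"
  let ?t = "\<lambda>(i, j, k). axis i 1 \<otimes>\<^sub>o axis j 1 \<otimes>\<^sub>o axis k (1::real) :: real^'n3^'n2^'n1"
  have "T $ a $ b $ c = (\<Sum>p\<in>UNIV. ?c p *\<^sub>R ?t p) $ a $ b $ c" for a b c
  proof -
    have "?c p * ?t p $ a $ b $ c = (if p = (a, b, c) then T $ a $ b $ c else 0)" for p
      by (cases p) (auto simp: axis_def)
    then show ?thesis by simp
  qed
  then have "T = (\<Sum>p\<in>UNIV. ?c p *\<^sub>R ?t p)"
    unfolding vec_eq_iff by blast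
  with nuclear_costs_sum[of UNIV ?c "\<lambda>p. axis (fst p) 1" "\<lambda>p. axis (fst (snd p)) 1"
      "\<lambda>p. axis (snd (snd p)) 1"]
  show ?thesis by (auto simp: case_prod_beta)
qed

lemma nuclear_costs_nonneg: "c \<in> nuclear_costs T \<Longrightarrow> 0 \<le> c"
  by (auto simp: nuclear_costs_def sum_nonneg)

lemma nuclear_norm_le: "c \<in> nuclear_costs T \<Longrightarrow> nuclear_norm T \<le> c"
  unfolding nuclear_norm_def
  by (rule cInf_lower) (auto simp: bdd_below_def intro: nuclear_costs_nonneg)

lemma rank_one_units_sum_nuclear_costs:
  assumes "finite F" "F \<subseteq> rank_one_units" "\<And>s. s \<in> F \<Longrightarrow> 0 \<le> u s"
  shows "(\<Sum>s\<in>F. u s) \<in> nuclear_costs (\<Sum>s\<in>F. u s *\<^sub>R s)"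
proof -
  have "\<forall>s\<in>F. \<exists>x y z. s = x \<otimes>\<^sub>o y \<otimes>\<^sub>o z \<and> norm x = 1 \<and> norm y = 1 \<and> norm z = 1"
    using assms(2) unfolding rank_one_units_def by blast
  then obtain x y z where "\<And>s. s \<in> F \<Longrightarrow> s = x s \<otimes>\<^sub>o y s \<otimes>\<^sub>o z s \<and> norm (x s) = 1 \<and>
      norm (y s) = 1 \<and> norm (z s) = 1"
    by metis
  with assms(3) nuclear_costs_sum[OF assms(1), of u x y z] show ?thesis
    by (simp cong: sum.cong)
qed

text \<open>This is the gauge description. Signs are absorbed into the first factors, and dividing
  the coefficients by their sum \<open>c\<close> turns the decomposition into a convex
  combination.\<close>

lemma nuclear_costs_eq:
  "nuclear_costs T = {c. 0 \<le> c \<and> (\<exists>k \<in> convex hull rank_one_units. T = c *\<^sub>R k)}"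
proof (intro set_eqI iffI)
  fix c
  assume c: "c \<in> nuclear_costs T"
  then obtain R l x y z where
    eq: "c = (\<Sum>r=1..R. \<bar>l r\<bar>)" "T = (\<Sum>r=1..R::nat. l r *\<^sub>R (x r \<otimes>\<^sub>o y r \<otimes>\<^sub>o z r))"
    and unit: "\<And>r. r \<in> {1..R} \<Longrightarrow> norm (x r) = 1 \<and> norm (y r) = 1 \<and> norm (z r) = 1"
    unfolding nuclear_costs_def by blast
  define s where "s r = (if l r < 0 then - x r else x r) \<otimes>\<^sub>o y r \<otimes>\<^sub>o z r" for r
  have s: "s r \<in> rank_one_units" if "r \<in> {1..R}" for r
    unfolding s_def rank_one_units_def using unit[OF that]
    by (intro CollectI exI[of _ "if l r < 0 then - x r else x r"] exI[of _ "y r"] exI[of _ "z r"])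
      auto
  have T: "T = (\<Sum>r=1..R. \<bar>l r\<bar> *\<^sub>R s r)"
    unfolding eq(2) s_def by (intro sum.cong) (auto simp: vec_eq_iff)
  have "\<exists>k \<in> convex hull rank_one_units. T = c *\<^sub>R k"
  proof (cases "c = 0")
    case True
    then have "T = 0"
      using T eq(1) by (simp add: sum_nonneg_eq_0_iff)
    \<comment> \<open>For \<open>c = 0\<close> division is impossible, but any point of the hull
      works; this one shows that the hull is nonempty.\<close>
    moreover have "axis undefined 1 \<otimes>\<^sub>o axis undefined 1 \<otimes>\<^sub>o axis undefined 1 \<in> rank_one_units"
      unfolding rank_one_units_def by (blast intro: norm_axis_1)
    ultimately show ?thesis
      using True by (metis hull_inc scaleR_zero_left)
  next
    case False
    have "(\<Sum>r=1..R. (\<bar>l r\<bar> / c) *\<^sub>R s r) \<in> convex hull rank_one_units"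
    proof (rule convex_sum)
      show "(\<Sum>r=1..R. \<bar>l r\<bar> / c) = 1"
        using False eq(1) by (simp flip: sum_divide_distrib)
    qed (use s nuclear_costs_nonneg[OF c] in \<open>auto intro: hull_inc\<close>)
    moreover have "T = c *\<^sub>R (\<Sum>r=1..R. (\<bar>l r\<bar> / c) *\<^sub>R s r)"
      using T False by (simp add: scaleR_sum_right)
    ultimately show ?thesis by blast
  qed
  with nuclear_costs_nonneg[OF c]
  show "c \<in> {c. 0 \<le> c \<and> (\<exists>k \<in> convex hull rank_one_units. T = c *\<^sub>R k)}"
    by simp
next
  fix c
  assume "c \<in> {c. 0 \<le> c \<and> (\<exists>k \<in> convex hull rank_one_units. T = c *\<^sub>R k)}"
  then obtain F u where "0 \<le> c" "finite F" "F \<subseteq> rank_one_units" "\<And>s. s \<in> F \<Longrightarrow> 0 \<le> u s"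
    "sum u F = 1" "T = c *\<^sub>R (\<Sum>s\<in>F. u s *\<^sub>R s)"
    unfolding convex_hull_explicit by auto
  with rank_one_units_sum_nuclear_costs[of F "\<lambda>s. c * u s"] show "c \<in> nuclear_costs T"
    by (simp add: scaleR_sum_right flip: sum_distrib_left)
qed

text \<open>Pairs \<open>(c, k)\<close> with \<open>c *\<^sub>R k = T\<close>, \<open>k\<close> in
  the hull and \<open>c\<close> bounded by some known cost form a compact set, on which the first
  coordinate attains its minimum.\<close>

lemma nuclear_norm_attained: "nuclear_norm T \<in> nuclear_costs (T :: real^'n3^'n2^'n1)"
proof -
  let ?H = "convex hull rank_one_units :: (real^'n3^'n2^'n1) set"
  obtain C where C: "C \<in> nuclear_costs T"
    using nuclear_costs_nonempty by blast
  \<comment> \<open>Cutting off at \<open>C\<close> gives compactness; costs above \<open>C\<close>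
    cannot undercut the minimum found below it.\<close>
  define K where "K = ({0..C} \<times> ?H) \<inter> {p. fst p *\<^sub>R snd p = T}"
  have "compact K"
    unfolding K_def
    by (intro compact_Int_closed compact_Times compact_Icc compact_convex_hull
        compact_rank_one_units closed_Collect_eq continuous_intros)
  moreover have K: "(c, k) \<in> K \<longleftrightarrow> 0 \<le> c \<and> c \<le> C \<and> k \<in> ?H \<and> T = c *\<^sub>R k" for c k
    by (auto simp: K_def)
  moreover from this C have "K \<noteq> {}"
    by (auto simp: nuclear_costs_eq)
  ultimately have "\<exists>p\<in>K. \<forall>q\<in>K. fst p \<le> fst q"
    by (intro continuous_attains_inf continuous_on_fst continuous_on_id)
  then obtain c k where min: "(c, k) \<in> K" "\<And>q. q \<in> K \<Longrightarrow> c \<le> fst q"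
    by (metis fst_conv surj_pair)
  from min(1) have c: "c \<in> nuclear_costs T"
    unfolding K nuclear_costs_eq by blast
  have "c \<le> d" if "d \<in> nuclear_costs T" for d
  proof (cases "d \<le> C")
    case True
    from that obtain k' where "0 \<le> d" "k' \<in> ?H" "T = d *\<^sub>R k'"
      unfolding nuclear_costs_eq by blast
    with True have "(d, k') \<in> K"
      unfolding K by blast
    from min(2)[OF this] show ?thesis by simp
  next
    case False
    with min(1)[unfolded K] show ?thesis by linarith
  qed
  with c have "nuclear_norm T = c"
    unfolding nuclear_norm_def by (intro cInf_eq_minimum) auto
  with c show ?thesis by simp
qed

section \<open>Conic Caratheodory reduction\<close>

text \<open>The coefficients move along a linear dependency until one of them reaches zero;
  orienting the dependency suitably keeps their sum from growing.\<close>

lemma conic_reduction_step: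
  fixes F :: "'v::real_vector set"
  assumes "finite F" "dependent F" "\<forall>s\<in>F. 0 \<le> u s"
  obtains a w where "a \<in> F" "\<forall>s\<in>F. 0 \<le> w s" "w a = 0" "sum w F \<le> sum u F"
    "(\<Sum>s\<in>F. w s *\<^sub>R s) = (\<Sum>s\<in>F. u s *\<^sub>R s)"
proof -
  obtain m0 where m0: "\<exists>s\<in>F. m0 s \<noteq> 0" "(\<Sum>s\<in>F. m0 s *\<^sub>R s) = 0"
    using assms(1,2) dependent_finite by blast
  \<comment> \<open>The sign makes \<open>sum m F\<close> nonnegative, so subtracting a nonnegative
    multiple of \<open>m\<close> cannot raise the total weight.\<close>
  define m where "m s = (if sum m0 F < 0 then - m0 s else m0 s)" for s
  have m: "\<exists>s\<in>F. m s \<noteq> 0" "(\<Sum>s\<in>F. m s *\<^sub>R s) = 0" "0 \<le> sum m F"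
    using m0 unfolding m_def by (cases "sum m0 F < 0"; auto simp: sum_negf)+
  define P where "P = {s \<in> F. 0 < m s}"
  \<comment> \<open>Without a positive entry, a nonnegative sum would force every \<open>m s\<close>
    to be zero.\<close>
  have "P \<noteq> {}"
  proof
    assume "P = {}"
    then have *: "\<And>s. s \<in> F \<Longrightarrow> 0 \<le> - m s"
      by (force simp: P_def)
    with m(3) have "sum (\<lambda>s. - m s) F = 0"
      using sum_nonneg[of F "\<lambda>s. - m s"] by (simp add: sum_negf)
    with * m(1) assms(1) show False
      using sum_nonneg_eq_0_iff[of F "\<lambda>s. - m s"] by auto
  qed
  moreover have "finite P"
    using assms(1) by (simp add: P_def)
  \<comment> \<open>Ratio test: the smallest ratio is the longest step that keeps all weights
    nonnegative, and it annihilates the weight of \<open>a\<close>.\<close>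
  ultimately obtain a where a: "a \<in> P" "\<And>s. s \<in> P \<Longrightarrow> u a / m a \<le> u s / m s"
    using arg_min_if_finite[of P "\<lambda>s. u s / m s"] by (metis not_le)
  define t where "t = u a / m a"
  have t: "0 \<le> t"
    using a(1) assms(3) by (simp add: t_def P_def)
  define w where "w s = u s - t * m s" for s
  show thesis
  proof
    show "a \<in> F" "w a = 0"
      using a(1) by (auto simp: P_def w_def t_def)
    have "0 \<le> w s" if "s \<in> F" for s
    proof (cases "0 < m s")
      case True
      with a(2)[of s] that show ?thesis by (simp add: P_def w_def t_def field_simps)
    next
      case False
      with t have "t * m s \<le> 0" by (simp add: mult_nonneg_nonpos)
      with assms(3) that show ?thesis by (force simp: w_def)
    qed
    then show "\<forall>s\<in>F. 0 \<le> w s" by blast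
    show "sum w F \<le> sum u F"
      using t m(3) by (simp add: w_def sum_subtractf flip: sum_distrib_left)
    have "(\<Sum>s\<in>F. w s *\<^sub>R s) = (\<Sum>s\<in>F. u s *\<^sub>R s) - t *\<^sub>R (\<Sum>s\<in>F. m s *\<^sub>R s)"
      by (simp add: w_def scaleR_diff_left sum_subtractf scaleR_sum_right)
    with m(2) show "(\<Sum>s\<in>F. w s *\<^sub>R s) = (\<Sum>s\<in>F. u s *\<^sub>R s)" by simp
  qed
qed

text \<open>Linear rather than affine independence is reached because the total weight may drop
  instead of being preserved. This yields the bound \<open>n1 n2 n3\<close> without an additional
  1.\<close>

lemma conic_caratheodory:
  fixes F :: "'v::real_vector set"
  assumes "finite F" "\<forall>s\<in>F. 0 \<le> u s"
  shows "\<exists>G w. G \<subseteq> F \<and> independent G \<and> (\<forall>s\<in>G. 0 \<le> w s) \<and> sum w G \<le> sum u F \<and>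
    (\<Sum>s\<in>G. w s *\<^sub>R s) = (\<Sum>s\<in>F. u s *\<^sub>R s)"
  using assms
proof (induction "card F" arbitrary: F u rule: less_induct)
  case less
  show ?case
  proof (cases "dependent F")
    case False
    with less.prems show ?thesis by blast
  next
    case True
    obtain a w where w: "a \<in> F" "\<forall>s\<in>F. 0 \<le> w s" "w a = 0" "sum w F \<le> sum u F"
      "(\<Sum>s\<in>F. w s *\<^sub>R s) = (\<Sum>s\<in>F. u s *\<^sub>R s)"
      by (rule conic_reduction_step[OF less.prems(1) True less.prems(2)])
    have "card (F - {a}) < card F"
      using less.prems(1) w(1) by (rule card_Diff1_less)
    then obtain G v where "G \<subseteq> F - {a}" "independent G" "\<forall>s\<in>G. 0 \<le> v s"
      "sum v G \<le> sum w (F - {a})" "(\<Sum>s\<in>G. v s *\<^sub>R s) = (\<Sum>s\<in>F - {a}. w s *\<^sub>R s)"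
      using less.hyps[of "F - {a}" w] less.prems(1) w(2) by auto
    moreover have "sum w (F - {a}) = sum w F" "(\<Sum>s\<in>F - {a}. w s *\<^sub>R s) = (\<Sum>s\<in>F. w s *\<^sub>R s)"
      using less.prems(1) w(1,3) by (simp_all add: sum_diff1)
    ultimately show ?thesis
      using w(4,5) by (metis Diff_subset order_trans)
  qed
qed

lemma nuclear_norm_decomposition:
  fixes T :: "real^'n3^'n2^'n1"
  obtains F u where "finite F" "F \<subseteq> rank_one_units" "card F \<le> CARD('n1) * CARD('n2) * CARD('n3)"
    "\<And>s. s \<in> F \<Longrightarrow> 0 \<le> u s" "T = (\<Sum>s\<in>F. u s *\<^sub>R s)" "nuclear_norm T = sum u F"
proof -
  obtain k where k: "0 \<le> nuclear_norm T" "k \<in> convex hull rank_one_units"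
    "T = nuclear_norm T *\<^sub>R k"
    using nuclear_norm_attained[of T] unfolding nuclear_costs_eq by blast
  from k(2) obtain F u where F: "finite F" "F \<subseteq> rank_one_units" "\<And>s. s \<in> F \<Longrightarrow> 0 \<le> u s"
    "sum u F = 1" "k = (\<Sum>s\<in>F. u s *\<^sub>R s)"
    unfolding convex_hull_explicit by auto
  \<comment> \<open>Rescaling makes the weights decompose \<open>T\<close> itself, with total weight
    \<open>nuclear_norm T\<close>.\<close>
  define v where "v s = nuclear_norm T * u s" for s
  have "\<forall>s\<in>F. 0 \<le> v s"
    using F(3) k(1) by (simp add: v_def)
  from conic_caratheodory[OF F(1) this] obtain G w where
    G: "G \<subseteq> F" "independent G" "\<forall>s\<in>G. 0 \<le> w s" "sum w G \<le> sum v F"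
      "(\<Sum>s\<in>G. w s *\<^sub>R s) = (\<Sum>s\<in>F. v s *\<^sub>R s)"
    by (elim exE conjE)
  have "(\<Sum>s\<in>F. v s *\<^sub>R s) = nuclear_norm T *\<^sub>R k"
    unfolding v_def F(5) scaleR_sum_right by simp
  then have v: "sum v F = nuclear_norm T" "(\<Sum>s\<in>F. v s *\<^sub>R s) = T"
    using F(4) k(3) by (simp_all add: v_def flip: sum_distrib_left)
  have fin: "finite G" "card G \<le> CARD('n1) * CARD('n2) * CARD('n3)"
    using independent_bound[OF G(2)] by (simp_all add: mult_ac)
  \<comment> \<open>The reduction does not raise the cost, and the reduced cost is again a cost of
    \<open>T\<close>, hence not below the infimum.\<close>
  moreover have "nuclear_norm T = sum w G"
    using rank_one_units_sum_nuclear_costs[OF fin(1), of w] G F(2) v nuclear_norm_le[of "sum w G" T]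
    by force
  ultimately show thesis
    using that[of G w] G F(2) v by auto
qed

section \<open>The semidefinite program\<close>

text \<open>The lower bound in the minimum, valid for every finite set of unit vectors: a feasible
  family yields a decomposition of \<open>T\<close> that costs at most half the total trace.\<close>

lemma nuclear_norm_le_half_trace:
  fixes T :: "real^'n3^'n2^'n1"
  assumes "finite \<Theta>" "\<Theta> \<subseteq> sphere 0 1" "T = (\<Sum>x\<in>\<Theta>. x \<otimes>\<^sub>o \<Gamma> x)"
    and block: "\<And>x. x \<in> \<Theta> \<Longrightarrow> \<Lambda> x = block_matrix (\<Lambda>1 x) (\<Gamma> x) (transpose (\<Gamma> x)) (\<Lambda>2 x)"
    and psd: "\<And>x. x \<in> \<Theta> \<Longrightarrow> psd (\<Lambda> x)"
  shows "nuclear_norm T \<le> 1/2 * (\<Sum>x\<in>\<Theta>. trace (\<Lambda> x))"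
proof -
  have "\<forall>x\<in>\<Theta>. \<exists>v :: 'n2 + 'n3 \<Rightarrow> real^('n2 + 'n3). \<Lambda> x = (\<Sum>j\<in>UNIV. v j \<otimes>\<^sub>o v j)"
    using psd psd_eq_sum_outer by metis
  then obtain v :: "real^'n1 \<Rightarrow> 'n2 + 'n3 \<Rightarrow> real^('n2 + 'n3)"
    where v: "\<And>x. x \<in> \<Theta> \<Longrightarrow> \<Lambda> x = (\<Sum>j\<in>UNIV. v x j \<otimes>\<^sub>o v x j)"
    by metis
  define a where "a x j = (\<chi> p. v x j $ Inl p)" for x j
  define b where "b x j = (\<chi> q. v x j $ Inr q)" for x j
  \<comment> \<open>Comparison of the upper right blocks in the decomposition of
    \<open>\<Lambda> x\<close>.\<close>
  have \<Gamma>: "\<Gamma> x = (\<Sum>j\<in>UNIV. a x j \<otimes>\<^sub>o b x j)" if "x \<in> \<Theta>" for x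
  proof -
    have "\<Gamma> x $ p $ q = \<Lambda> x $ Inl p $ Inr q" for p q
      using block[OF that] by simp
    then show ?thesis
      using v[OF that] by (simp add: vec_eq_iff a_def b_def)
  qed
  have tr: "trace (\<Lambda> x) = (\<Sum>j\<in>UNIV. (norm (a x j))\<^sup>2 + (norm (b x j))\<^sup>2)" if "x \<in> \<Theta>" for x
    using v[OF that] by (simp add: trace_sum trace_outer inner_sum_index a_def b_def)
  have "T = (\<Sum>x\<in>\<Theta>. \<Sum>j\<in>UNIV. x \<otimes>\<^sub>o a x j \<otimes>\<^sub>o b x j)"
    using assms(3) by (simp add: \<Gamma> outer_sum_right)
  also have "\<dots> = (\<Sum>i\<in>\<Theta> \<times> UNIV.
      1 *\<^sub>R (fst i \<otimes>\<^sub>o a (fst i) (snd i) \<otimes>\<^sub>o b (fst i) (snd i)))"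
    by (simp add: sum.cartesian_product case_prod_beta)
  finally have "(\<Sum>i\<in>\<Theta> \<times> UNIV.
      \<bar>1\<bar> * (norm (fst i) * norm (a (fst i) (snd i)) * norm (b (fst i) (snd i)))) \<in> nuclear_costs T"
    using nuclear_costs_sum[of "\<Theta> \<times> UNIV" "\<lambda>_. 1" fst "\<lambda>i. a (fst i) (snd i)" "\<lambda>i. b (fst i) (snd i)"]
      assms(1) by simp
  from nuclear_norm_le[OF this]
  have "nuclear_norm T \<le> (\<Sum>x\<in>\<Theta>. \<Sum>j\<in>UNIV. norm x * norm (a x j) * norm (b x j))"
    by (simp add: sum.cartesian_product case_prod_beta)
  \<comment> \<open>Arithmetic-geometric mean inequality, termwise; \<open>norm x = 1\<close>
    removes the first factor.\<close>
  also have "\<dots> \<le> (\<Sum>x\<in>\<Theta>. \<Sum>j\<in>UNIV. 1/2 * ((norm (a x j))\<^sup>2 + (norm (b x j))\<^sup>2))"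
  proof (intro sum_mono)
    fix x j
    assume "x \<in> \<Theta>"
    with assms(2) have "norm x = 1" by auto
    then show "norm x * norm (a x j) * norm (b x j) \<le> 1/2 * ((norm (a x j))\<^sup>2 + (norm (b x j))\<^sup>2)"
      using sum_squares_bound[of "norm (a x j)" "norm (b x j)"] by simp
  qed
  also have "\<dots> = 1/2 * (\<Sum>x\<in>\<Theta>. trace (\<Lambda> x))"
    by (simp add: tr sum_distrib_left)
  finally show ?thesis .
qed

theorem theorem1:
  fixes T :: "real^'n3^'n2^'n1"
  shows "\<exists>\<Theta> :: (real^'n1) set.
    \<Theta> \<subseteq> sphere 0 1 \<and> finite \<Theta> \<and> card \<Theta> \<le> CARD('n1) * CARD('n2) * CARD('n3) \<and>
    is_minimum (nuclear_norm T)
      {1/2 * (\<Sum>x\<in>\<Theta>. trace (\<Lambda> x)) | \<Lambda> \<Lambda>1 \<Lambda>2 \<Gamma>.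
         T = (\<Sum>x\<in>\<Theta>. x \<otimes>\<^sub>o \<Gamma> x) \<and>
         (\<forall>x\<in>\<Theta>. \<Lambda> x = block_matrix (\<Lambda>1 x) (\<Gamma> x) (transpose (\<Gamma> x)) (\<Lambda>2 x) \<and> psd (\<Lambda> x))}"
proof -
  obtain F u where F: "finite F" "F \<subseteq> rank_one_units"
    "card F \<le> CARD('n1) * CARD('n2) * CARD('n3)" "\<And>s. s \<in> F \<Longrightarrow> 0 \<le> u s"
    "T = (\<Sum>s\<in>F. u s *\<^sub>R s)" "nuclear_norm T = sum u F"
    using nuclear_norm_decomposition by blast
  have "\<forall>s\<in>F. \<exists>x y z. s = x \<otimes>\<^sub>o y \<otimes>\<^sub>o z \<and> norm x = 1 \<and> norm y = 1 \<and> norm z = 1"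
    using F(2) unfolding rank_one_units_def by blast
  then obtain X Y Z where XYZ: "\<And>s. s \<in> F \<Longrightarrow> X s \<otimes>\<^sub>o Y s \<otimes>\<^sub>o Z s = s"
    and unit: "\<And>s. s \<in> F \<Longrightarrow> norm (X s) = 1 \<and> norm (Y s) = 1 \<and> norm (Z s) = 1"
    by metis
  define \<Theta> where "\<Theta> = X ` F"
  \<comment> \<open>Several terms may share a first factor, so \<open>\<Theta>\<close> can be
    smaller than \<open>F\<close>; the sets \<open>D x\<close> partition \<open>F\<close>
    accordingly.\<close>
  define D where "D x = {s \<in> F. X s = x}" for x
  define \<Lambda>1 where "\<Lambda>1 x = (\<Sum>s\<in>D x. u s *\<^sub>R (Y s \<otimes>\<^sub>o Y s))" for x
  define \<Gamma> where "\<Gamma> x = (\<Sum>s\<in>D x. u s *\<^sub>R (Y s \<otimes>\<^sub>o Z s))" for x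
  define \<Lambda>2 where "\<Lambda>2 x = (\<Sum>s\<in>D x. u s *\<^sub>R (Z s \<otimes>\<^sub>o Z s))" for x
  \<comment> \<open>The vector \<open>Y s\<close> stacked on \<open>Z s\<close>: its outer square
    carries \<open>Y s \<otimes>\<^sub>o Z s\<close> in the upper right block.\<close>
  define W where "W s = (\<chi> i. case i of Inl p \<Rightarrow> Y s $ p | Inr q \<Rightarrow> Z s $ q)" for s
  define \<Lambda> where "\<Lambda> x = (\<Sum>s\<in>D x. u s *\<^sub>R (W s \<otimes>\<^sub>o W s))" for x
  have \<Theta>: "finite \<Theta>" "\<Theta> \<subseteq> sphere 0 1" "card \<Theta> \<le> CARD('n1) * CARD('n2) * CARD('n3)"
    using F(1,3) unit card_image_le[OF F(1), of X] by (auto simp: \<Theta>_def)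
  have group: "(\<Sum>x\<in>\<Theta>. \<Sum>s\<in>D x. f s) = (\<Sum>s\<in>F. f s)" for f :: "_ \<Rightarrow> 'b::comm_monoid_add"
    unfolding \<Theta>_def D_def by (rule sum.image_gen[OF F(1), symmetric])
  have "(\<Sum>x\<in>\<Theta>. x \<otimes>\<^sub>o \<Gamma> x) = (\<Sum>x\<in>\<Theta>. \<Sum>s\<in>D x. u s *\<^sub>R s)"
    unfolding \<Gamma>_def outer_sum_right
    by (intro sum.cong refl) (auto simp: D_def outer_scaleR_right XYZ)
  then have T: "T = (\<Sum>x\<in>\<Theta>. x \<otimes>\<^sub>o \<Gamma> x)"
    using F(5) by (simp add: group)
  have W: "W s \<otimes>\<^sub>o W s
      = block_matrix (Y s \<otimes>\<^sub>o Y s) (Y s \<otimes>\<^sub>o Z s) (Z s \<otimes>\<^sub>o Y s) (Z s \<otimes>\<^sub>o Z s)" for s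
    by (simp add: block_matrix_outer_self W_def vec_lambda_eta)
  have "transpose (\<Gamma> x) = (\<Sum>s\<in>D x. u s *\<^sub>R (Z s \<otimes>\<^sub>o Y s))" for x
    by (simp add: \<Gamma>_def vec_eq_iff transpose_def mult_ac)
  then have block: "\<Lambda> x = block_matrix (\<Lambda>1 x) (\<Gamma> x) (transpose (\<Gamma> x)) (\<Lambda>2 x)" for x
    by (simp add: \<Lambda>_def \<Lambda>1_def \<Lambda>2_def \<Gamma>_def W block_matrix_scaleR block_matrix_sum)
  have psd: "psd (\<Lambda> x)" for x
    unfolding \<Lambda>_def using F(4) by (auto intro!: psd_sum psd_scaleR_outer_self simp: D_def)
  \<comment> \<open>Two stacked unit vectors contribute 1 each; the factor \<open>1/2\<close> in the
    objective compensates for this.\<close>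
  have "W s \<bullet> W s = 2" if "s \<in> F" for s
    using unit[OF that] by (simp add: inner_sum_index W_def vec_lambda_eta)
  then have "trace (u s *\<^sub>R (W s \<otimes>\<^sub>o W s)) = 2 * u s" if "s \<in> F" for s
    using that trace_outer[of "u s *\<^sub>R W s" "W s"] by (simp add: outer_scaleR_left)
  then have "(\<Sum>x\<in>\<Theta>. trace (\<Lambda> x)) = (\<Sum>s\<in>F. 2 * u s)"
    by (simp add: \<Lambda>_def trace_sum group)
  then have cost: "nuclear_norm T = 1/2 * (\<Sum>x\<in>\<Theta>. trace (\<Lambda> x))"
    using F(6) by (simp flip: sum_distrib_left)
  have "is_minimum (nuclear_norm T)
      {1/2 * (\<Sum>x\<in>\<Theta>. trace (\<Lambda> x)) | \<Lambda> \<Lambda>1 \<Lambda>2 \<Gamma>.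
         T = (\<Sum>x\<in>\<Theta>. x \<otimes>\<^sub>o \<Gamma> x) \<and>
         (\<forall>x\<in>\<Theta>. \<Lambda> x = block_matrix (\<Lambda>1 x) (\<Gamma> x) (transpose (\<Gamma> x)) (\<Lambda>2 x) \<and> psd (\<Lambda> x))}"
    unfolding is_minimum_def
  proof (intro conjI ballI, goal_cases)
    case 1
    show ?case
      using T block psd cost by blast
  next
    case (2 s)
    then show ?case
      using nuclear_norm_le_half_trace[OF \<Theta>(1,2)] by blast
  qed
  with \<Theta> show ?thesis by blast
qed

end
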